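(* Let $\tau\in\mathfrak M_{1,c}(\mathcal P)$ and suppose that $J_{\ker}(G_\tau)=\emptyset$. Then the function $T_{\infty,\tau}:\hat{\mathbb C}\to[0,1]$ is continuous on the whole of $\hat{\mathbb C}$, and $M_\tau(T_{\infty,\tau})=T_{\infty,\tau}$.
   Context: $\hat{\mathbb C}$ is the Riemann sphere with spherical distance $d$. $\mathcal P$ is the set of polynomial maps $\hat{\mathbb C}\to\hat{\mathbb C}$ of degree at least $2$, with the metric $\kappa(f,g)=\sup_zd(f(z),g(z))$. $\mathfrak M_{1,c}(\mathcal P)$ is the set of Borel probability measures on $\mathcal P$ with compact topological support. For a semigroup $G$ of non-constant rational maps, $F(G)$ is the set of $z$ having a neighborhood $U$ on which $\{g|_U\}_{g\in G}$ is equicontinuous with respect to $d$; $J(G)=\hat{\mathbb C}\setminus F(G)$; $J_{\ker}(G)=\bigcap_{g\in G}g^{-1}(J(G))$. $G_\tau$ is the semigroup generated under composition by $\operatorname{supp}\tau$, and $\tilde\tau=\otimes_{j=1}^\infty\tau$ is the product measure on sequences $\gamma=(\gamma_1,\gamma_2,\dots)$. $T_{\infty,\tau}(z)=\tilde\tau(\{\gamma:\ \gamma_n\circ\cdots\circ\gamma_1(z)\to\infty\text{ in }\hat{\mathbb C}\text{ as }n\to\infty\})$, and $M_\tau(\varphi)(z)=\int\varphi(g(z))\,d\tau(g)$. *)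

theory Defs
  imports "HOL-Probability.Probability" "HOL-Computational_Algebra.Polynomial"
begin

section \<open>The Riemann sphere with the spherical distance\<close>

datatype rsphere = Fin complex | Infty

fun stereo :: "rsphere \<Rightarrow> complex \<times> real" where
  "stereo (Fin z) = ((2 / (1 + (cmod z)\<^sup>2)) *\<^sub>R z, ((cmod z)\<^sup>2 - 1) / ((cmod z)\<^sup>2 + 1))"
| "stereo Infty = (0, 1)"

lemma norm_stereo: "norm (stereo x) = 1"
proof (cases x)
  case (Fin z)
  define t where "t = (cmod z)\<^sup>2"
  have t: "t \<ge> 0" by (simp add: t_def)
  have "(norm (stereo x))\<^sup>2 = (2 / (1 + t) * cmod z)\<^sup>2 + ((t - 1) / (t + 1))\<^sup>2"
    using t by (simp add: Fin norm_prod_def t_def power_mult_distrib power_divide)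
  also have "\<dots> = (4 * t + (t - 1)\<^sup>2) / (t + 1)\<^sup>2"
    by (simp add: power_mult_distrib power_divide t_def[symmetric] add_divide_distrib add.commute)
  also have "4 * t + (t - 1)\<^sup>2 = (t + 1)\<^sup>2"
    by (simp add: power2_eq_square algebra_simps)
  finally have "(norm (stereo x))\<^sup>2 = 1" using t by simp
  then show ?thesis using norm_ge_zero[of "stereo x"] unfolding power2_eq_1_iff by linarith
next
  case Infty
  then show ?thesis by (simp add: norm_prod_def)
qed

lemma stereo_inject: "stereo x = stereo y \<longleftrightarrow> x = y"
proof -
  have neq: "((cmod z)\<^sup>2 - 1) / ((cmod z)\<^sup>2 + 1) \<noteq> 1" for z
  proof -
    have "(cmod z)\<^sup>2 - 1 < (cmod z)\<^sup>2 + 1" "0 < (cmod z)\<^sup>2 + 1"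
      by (simp_all add: add_nonneg_pos)
    then show ?thesis by (metis divide_less_eq_1_pos less_irrefl)
  qed
  have inj: "z = w" if e: "stereo (Fin z) = stereo (Fin w)" for z w
  proof -
    define s t where "s = (cmod z)\<^sup>2" and "t = (cmod w)\<^sup>2"
    have st: "s \<ge> 0" "t \<ge> 0" by (auto simp: s_def t_def)
    have "(s - 1) / (s + 1) = (t - 1) / (t + 1)" using e by (simp add: s_def t_def)
    then have "(s - 1) * (t + 1) = (t - 1) * (s + 1)" using st by (simp add: frac_eq_eq)
    then have "s = t" by (simp add: algebra_simps)
    moreover have "(2 / (1 + s)) *\<^sub>R z = (2 / (1 + t)) *\<^sub>R w"
      using e by (simp add: s_def t_def)
    ultimately show ?thesis using st by simp
  qed
  show ?thesis
  proof (cases x; cases y)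
    fix z w assume "x = Fin z" "y = Fin w"
    then show ?thesis using inj[of z w] by auto
  qed (use neq neq[symmetric] in simp_all)
qed

lemma abs_inner_unit_le_1:
  fixes u v :: "'a::real_inner"
  assumes "norm u = 1" "norm v = 1"
  shows "\<bar>u \<bullet> v\<bar> \<le> 1"
  using Cauchy_Schwarz_ineq2[of u v] assms by simp

lemma arccos_inner_triangle:
  fixes u v w :: "'a::real_inner"
  assumes "norm u = 1" "norm v = 1" "norm w = 1"
  shows "arccos (u \<bullet> w) \<le> arccos (u \<bullet> v) + arccos (v \<bullet> w)"
proof -
  define a b where "a = u \<bullet> v" and "b = v \<bullet> w"
  have ab: "\<bar>a\<bar> \<le> 1" "\<bar>b\<bar> \<le> 1" "\<bar>u \<bullet> w\<bar> \<le> 1"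
    using assms by (auto simp: a_def b_def intro!: abs_inner_unit_le_1)
  have un: "u \<bullet> u = 1" "v \<bullet> v = 1" "w \<bullet> w = 1"
    using assms by (auto simp: dot_square_norm)
  have p: "(u - a *\<^sub>R v) \<bullet> (w - b *\<^sub>R v) = u \<bullet> w - a * b"
    "(u - a *\<^sub>R v) \<bullet> (u - a *\<^sub>R v) = 1 - a\<^sup>2" "(w - b *\<^sub>R v) \<bullet> (w - b *\<^sub>R v) = 1 - b\<^sup>2"
    using un by (simp_all add: inner_diff_left inner_diff_right inner_commute a_def b_def
        power2_eq_square algebra_simps)
  have cs: "\<bar>u \<bullet> w - a * b\<bar> \<le> sqrt (1 - a\<^sup>2) * sqrt (1 - b\<^sup>2)"
    using Cauchy_Schwarz_ineq2[of "u - a *\<^sub>R v" "w - b *\<^sub>R v"] unfolding norm_eq_sqrt_inner p .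
  have "cos (arccos a + arccos b) = a * b - sqrt (1 - a\<^sup>2) * sqrt (1 - b\<^sup>2)"
    using ab by (simp add: cos_add sin_arccos_abs cos_arccos_abs)
  with cs have c: "cos (arccos a + arccos b) \<le> u \<bullet> w" by linarith
  have bnd: "0 \<le> arccos a" "0 \<le> arccos b" "arccos (u \<bullet> w) \<le> pi"
    using ab by (auto intro!: arccos_lbound arccos_ubound)
  show ?thesis
  proof (cases "arccos a + arccos b \<le> pi")
    case True
    have "arccos (u \<bullet> w) \<le> arccos (cos (arccos a + arccos b))"
      by (rule arccos_le_arccos) (use c ab in auto)
    also have "\<dots> = arccos a + arccos b"
      using True bnd by (intro arccos_cos) auto
    finally show ?thesis by (simp add: a_def b_def)
  next
    case False
    then show ?thesis using bnd by (simp add: a_def b_def)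
  qed
qed

lemma arccos_inner_eq_0_iff:
  fixes u v :: "'a::real_inner"
  assumes "norm u = 1" "norm v = 1"
  shows "arccos (u \<bullet> v) = 0 \<longleftrightarrow> u = v"
proof
  assume "arccos (u \<bullet> v) = 0"
  then have "u \<bullet> v = 1"
    using cos_arccos_abs[OF abs_inner_unit_le_1[OF assms]] by simp
  moreover have "u \<bullet> u = 1" "v \<bullet> v = 1"
    using assms by (simp_all add: dot_square_norm)
  ultimately have "(u - v) \<bullet> (u - v) = 0"
    by (simp add: inner_diff_left inner_diff_right inner_commute del: inner_eq_zero_iff)
  then show "u = v" by simp
next
  assume "u = v"
  then show "arccos (u \<bullet> v) = 0" using assms by (simp add: dot_square_norm)
qed

text \<open>The distance is the great-circle distance on the unit sphere, that is, the distance
  induced by the Riemannian metric \<open>2 |dz| / (1 + |z|\<^sup>2)\<close>.\<close>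

instantiation rsphere :: metric_space
begin

definition dist_rsphere :: "rsphere \<Rightarrow> rsphere \<Rightarrow> real" where
  "dist_rsphere x y = arccos (stereo x \<bullet> stereo y)"

definition uniformity_rsphere :: "(rsphere \<times> rsphere) filter" where
  "uniformity_rsphere = (INF e\<in>{0<..}. principal {(x, y). dist x y < e})"

definition open_rsphere :: "rsphere set \<Rightarrow> bool" where
  "open_rsphere U = (\<forall>x\<in>U. \<forall>\<^sub>F (x', y) in uniformity. x' = x \<longrightarrow> y \<in> U)"

instance
proof
  fix x y z :: rsphere
  show "dist x y = 0 \<longleftrightarrow> x = y"
    unfolding dist_rsphere_def by (simp add: arccos_inner_eq_0_iff norm_stereo stereo_inject)
  show "dist x y \<le> dist x z + dist y z"
    unfolding dist_rsphere_def
    using arccos_inner_triangle[of "stereo x" "stereo z" "stereo y"]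
    by (simp add: norm_stereo inner_commute)
qed (simp_all only: uniformity_rsphere_def open_rsphere_def)

end

lemma dist_rsphere_le_pi: "dist (x::rsphere) y \<le> pi"
  unfolding dist_rsphere_def
  using abs_inner_unit_le_1[OF norm_stereo norm_stereo, of x y] by (auto intro!: arccos_ubound)

lemma bdd_above_dist_rsphere: "bdd_above (range (\<lambda>z. dist (f z :: rsphere) (g z)))"
  by (rule bdd_aboveI2[where M = pi]) (rule dist_rsphere_le_pi)


section \<open>Polynomial maps of degree at least 2\<close>

text \<open>For non-constant \<open>p\<close> this is the holomorphic extension of \<open>p\<close> to the sphere.\<close>

fun poly_sphere :: "complex poly \<Rightarrow> rsphere \<Rightarrow> rsphere" where
  "poly_sphere p (Fin z) = Fin (poly p z)"
| "poly_sphere p Infty = Infty"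

typedef polymap = "{f :: rsphere \<Rightarrow> rsphere. \<exists>p. degree p \<ge> 2 \<and> f = poly_sphere p}"
  morphisms apply_polymap Polymap
proof -
  have "degree (monom (1::complex) 2) \<ge> 2" by (simp add: degree_monom_eq)
  then show ?thesis by blast
qed

instantiation polymap :: metric_space
begin

definition dist_polymap :: "polymap \<Rightarrow> polymap \<Rightarrow> real" where
  "dist_polymap f g = (SUP z. dist (apply_polymap f z) (apply_polymap g z))"

definition uniformity_polymap :: "(polymap \<times> polymap) filter" where
  "uniformity_polymap = (INF e\<in>{0<..}. principal {(x, y). dist x y < e})"

definition open_polymap :: "polymap set \<Rightarrow> bool" where
  "open_polymap U = (\<forall>x\<in>U. \<forall>\<^sub>F (x', y) in uniformity. x' = x \<longrightarrow> y \<in> U)"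

instance
proof
  fix f g h :: polymap
  have le: "dist (apply_polymap a z) (apply_polymap b z) \<le> dist a b" for a b :: polymap and z
    unfolding dist_polymap_def by (rule cSUP_upper[OF UNIV_I bdd_above_dist_rsphere])
  show "dist f g = 0 \<longleftrightarrow> f = g"
  proof
    assume "dist f g = 0"
    then have "apply_polymap f z = apply_polymap g z" for z
      using le[where a = f and b = g and z = z] by simp
    then have "apply_polymap f = apply_polymap g" by (rule ext)
    then show "f = g" by (simp add: apply_polymap_inject)
  qed (simp add: dist_polymap_def)
  have "dist (apply_polymap f z) (apply_polymap g z) \<le> dist f h + dist g h" for z
    using dist_triangle2[of "apply_polymap f z" "apply_polymap g z" "apply_polymap h z"]
      le[of f z h] le[of g z h] by linarith
  then show "dist f g \<le> dist f h + dist g h"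
    unfolding dist_polymap_def[of f g] by (intro cSUP_least) auto
qed (simp_all only: uniformity_polymap_def open_polymap_def)

end


section \<open>Measures on the space of polynomial maps\<close>

definition supp :: "'a::topological_space measure \<Rightarrow> 'a set" where
  "supp \<mu> = {x. \<forall>U. open U \<and> x \<in> U \<longrightarrow> emeasure \<mu> U > 0}"

definition M1c :: "polymap measure set" where
  "M1c = {\<tau>. prob_space \<tau> \<and> sets \<tau> = sets borel \<and> compact (supp \<tau>)}"


section \<open>Semigroups, Fatou, Julia and kernel Julia sets\<close>

inductive_set generated_semigroup :: "('a \<Rightarrow> 'a) set \<Rightarrow> ('a \<Rightarrow> 'a) set"
  for S :: "('a \<Rightarrow> 'a) set" where
  gen: "g \<in> S \<Longrightarrow> g \<in> generated_semigroup S"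
| comp: "g \<in> generated_semigroup S \<Longrightarrow> h \<in> generated_semigroup S \<Longrightarrow>
    g \<circ> h \<in> generated_semigroup S"

definition equicontinuous_on ::
    "'a::metric_space set \<Rightarrow> ('a \<Rightarrow> 'b::metric_space) set \<Rightarrow> bool" where
  "equicontinuous_on U G \<longleftrightarrow>
    (\<forall>x\<in>U. \<forall>e>0. \<exists>d>0. \<forall>g\<in>G. \<forall>y\<in>U. dist x y < d \<longrightarrow> dist (g x) (g y) < e)"

definition Fatou :: "(rsphere \<Rightarrow> rsphere) set \<Rightarrow> rsphere set" where
  "Fatou G = {z. \<exists>U. open U \<and> z \<in> U \<and> equicontinuous_on U G}"

definition Julia :: "(rsphere \<Rightarrow> rsphere) set \<Rightarrow> rsphere set" where
  "Julia G = UNIV - Fatou G"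

definition Julia_ker :: "(rsphere \<Rightarrow> rsphere) set \<Rightarrow> rsphere set" where
  "Julia_ker G = (\<Inter>g\<in>G. g -` Julia G)"

definition semigroup_of :: "polymap measure \<Rightarrow> (rsphere \<Rightarrow> rsphere) set" where
  "semigroup_of \<tau> = generated_semigroup (apply_polymap ` supp \<tau>)"


section \<open>The probability of tending to infinity and the transition operator\<close>

text \<open>Sequences are indexed from \<open>0\<close>: \<open>\<gamma> n\<close> is the map usually written with index \<open>n + 1\<close>.\<close>

fun random_orbit :: "(nat \<Rightarrow> polymap) \<Rightarrow> nat \<Rightarrow> rsphere \<Rightarrow> rsphere" where
  "random_orbit \<gamma> 0 = id"
| "random_orbit \<gamma> (Suc n) = apply_polymap (\<gamma> n) \<circ> random_orbit \<gamma> n"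

definition T_infty :: "polymap measure \<Rightarrow> rsphere \<Rightarrow> real" where
  "T_infty \<tau> z =
    measure (PiM UNIV (\<lambda>_. \<tau>)) {\<gamma>. (\<lambda>n. random_orbit \<gamma> n z) \<longlonglongrightarrow> Infty}"

definition M_op :: "polymap measure \<Rightarrow> (rsphere \<Rightarrow> real) \<Rightarrow> rsphere \<Rightarrow> real" where
  "M_op \<tau> \<phi> z = (\<integral>g. \<phi> (apply_polymap g z) \<partial>\<tau>)"

end

(* On the Fatou set T_infty is locally constant: by compactness of the support there is a
   neighbourhood of infinity in which every random orbit escapes, and by equicontinuity the orbit of
   a point near z follows the orbit of z into it. Invariance under M_op is the shift invariance of
   the product measure.

   Let s be the supremum over the sphere of the oscillation of T_infty. The oscillation is upper
   semicontinuous, so if s > 0 then s is attained on a nonempty set A, which misses the Fatou set.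
   As T_infty is the average over f of its values at f z, the oscillation at z is at most the average
   of the oscillations at f z; hence z in A forces f z in A for all f in the support. So A is
   mapped into itself by the semigroup and lies in the kernel Julia set, which is empty. Thus s = 0. *)

theory Submission
  imports Defs "HOL-Complex_Analysis.Conformal_Mappings"
    "HOL-Computational_Algebra.Fundamental_Theorem_Algebra"
begin

section \<open>Topology of the Riemann sphere\<close>

lemma inner_stereo: "stereo x \<bullet> stereo y = cos (dist x y)"
  unfolding dist_rsphere_def by (simp add: cos_arccos_abs abs_inner_unit_le_1 norm_stereo)

text \<open>The chord length as a function of the great-circle distance: expanding the square of a
  difference of unit vectors leaves only their inner product.\<close>

lemma norm_stereo_diff: "norm (stereo x - stereo y) = sqrt (2 - 2 * cos (dist x y))"
proof -
  have "stereo x \<bullet> stereo x = 1" "stereo y \<bullet> stereo y = 1"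
    by (simp_all add: dot_square_norm norm_stereo)
  then have "(stereo x - stereo y) \<bullet> (stereo x - stereo y) = 2 - 2 * (stereo x \<bullet> stereo y)"
    by (simp add: inner_diff_left inner_diff_right inner_commute del: inner_eq_zero_iff)
  then show ?thesis by (simp add: norm_eq_sqrt_inner inner_stereo)
qed

text \<open>Chordal and great-circle distance determine each other continuously, through
  \<open>cos\<close> one way and \<open>arccos\<close> the other. Convergence on the sphere can thus
  be checked in \<open>complex \<times> real\<close>, where the usual limit rules apply.\<close>

lemma tendsto_rsphere_iff:
  "(f \<longlongrightarrow> l) F \<longleftrightarrow> ((\<lambda>x. stereo (f x)) \<longlongrightarrow> stereo l) F"
proof
  assume "(f \<longlongrightarrow> l) F"
  then have "((\<lambda>x. cos (dist (f x) l)) \<longlongrightarrow> cos (dist l l)) F"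
    by (intro isCont_tendsto_compose[OF isCont_cos, of "\<lambda>x. dist (f x) l"] tendsto_dist tendsto_const)
  then have "((\<lambda>x. sqrt (2 - 2 * cos (dist (f x) l))) \<longlongrightarrow> sqrt (2 - 2 * cos (dist l l))) F"
    by (rule tendsto_real_sqrt[OF tendsto_diff[OF tendsto_const tendsto_mult[OF tendsto_const]]])
  then show "((\<lambda>x. stereo (f x)) \<longlongrightarrow> stereo l) F"
    by (simp add: norm_stereo_diff[symmetric] tendsto_norm_zero_iff LIM_zero_iff)
next
  assume *: "((\<lambda>x. stereo (f x)) \<longlongrightarrow> stereo l) F"
  have "((\<lambda>x. arccos (stereo (f x) \<bullet> stereo l)) \<longlongrightarrow> arccos (stereo l \<bullet> stereo l)) F"
  proof (rule continuous_on_tendsto_compose[OF continuous_on_arccos'])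
    show "((\<lambda>x. stereo (f x) \<bullet> stereo l) \<longlongrightarrow> stereo l \<bullet> stereo l) F"
      by (intro tendsto_intros *)
    have "stereo x \<bullet> stereo y \<in> {-1..1}" for x y
      using abs_inner_unit_le_1[OF norm_stereo norm_stereo, of x y]
      unfolding atLeastAtMost_iff by linarith
    then show "stereo l \<bullet> stereo l \<in> {-1..1}"
      and "\<forall>\<^sub>F x in F. stereo (f x) \<bullet> stereo l \<in> {-1..1}" by simp_all
  qed
  then show "(f \<longlongrightarrow> l) F"
    unfolding dist_rsphere_def[symmetric] by (subst tendsto_dist_iff) simp
qed

lemma continuous_on_stereo [continuous_intros]:
  "continuous_on S f \<Longrightarrow> continuous_on S (\<lambda>x. stereo (f x))"
  by (simp add: continuous_on_def tendsto_rsphere_iff)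

lemma range_stereo: "range stereo = sphere 0 1"
proof (intro equalityI subsetI)
  fix p :: "complex \<times> real" assume "p \<in> sphere 0 1"
  then obtain u t where p: "p = (u, t)" and ut: "(cmod u)\<^sup>2 + t\<^sup>2 = 1"
    by (cases p) (auto simp: norm_prod_def)
  show "p \<in> range stereo"
  proof (cases "t = 1")
    case True
    then have "p = stereo Infty" using ut p by simp
    then show ?thesis by blast
  next
    case False
    have "t\<^sup>2 \<le> 1" using ut zero_le_power2[of "cmod u"] by linarith
    then have t: "t < 1" using False by (simp add: abs_square_le_1 abs_le_iff)
    \<comment> \<open>The projection of \<open>(u, t)\<close> from the north pole
      \<open>(0, 1)\<close> to the plane.\<close>
    define z where "z = (1 / (1 - t)) *\<^sub>R u"
    have "(cmod z)\<^sup>2 = (1 - t\<^sup>2) / (1 - t)\<^sup>2"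
      using ut by (simp add: z_def power_divide eq_diff_eq)
    also have "\<dots> = (1 + t) / (1 - t)"
    proof -
      have "1 - t\<^sup>2 = (1 + t) * (1 - t)" by (simp add: power2_eq_square algebra_simps)
      then show ?thesis using t by (simp add: power2_eq_square)
    qed
    finally have z: "(cmod z)\<^sup>2 = (1 + t) / (1 - t)" .
    have "1 + (cmod z)\<^sup>2 = 2 / (1 - t)" "(cmod z)\<^sup>2 - 1 = 2 * t / (1 - t)"
      using t by (simp_all add: z field_simps)
    then have "stereo (Fin z) = p"
      using t by (simp add: p z_def add.commute)
    then show ?thesis by blast
  qed
qed (auto simp: norm_stereo)

text \<open>Convergence is tested after applying \<open>stereo\<close>, where the inverse becomes
  the identity on the unit sphere.\<close>

lemma continuous_on_inv_stereo: "continuous_on (sphere 0 1) (inv stereo)"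
  unfolding continuous_on_def tendsto_rsphere_iff
proof
  fix p :: "complex \<times> real" assume p: "p \<in> sphere 0 1"
  then have eq: "stereo (inv stereo q) = q" if "q \<in> sphere 0 1" for q
    using that range_stereo f_inv_into_f by metis
  have "((\<lambda>q. q) \<longlongrightarrow> p) (at p within sphere 0 1)" by simp
  then show "((\<lambda>q. stereo (inv stereo q)) \<longlongrightarrow> stereo (inv stereo p)) (at p within sphere 0 1)"
    unfolding eq[OF p]
  proof (rule Lim_transform_eventually)
    have "q \<in> sphere 0 1 \<longrightarrow> q = stereo (inv stereo q)" for q
      using eq[of q] by argo
    then show "eventually (\<lambda>q. q = stereo (inv stereo q)) (at p within sphere 0 1)"
      unfolding eventually_at_filter by (intro always_eventually) blast
  qed
qed

lemma inj_stereo: "inj stereo"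
  by (simp add: inj_def stereo_inject)

lemma compact_UNIV_rsphere: "compact (UNIV :: rsphere set)"
proof -
  have "inv stereo ` sphere 0 1 = UNIV"
    unfolding range_stereo[symmetric] by (simp add: image_image inj_stereo)
  then show ?thesis
    using compact_continuous_image[OF continuous_on_inv_stereo] by simp
qed

text \<open>Since \<open>stereo\<close> is a homeomorphism onto the unit sphere, the topology is the
  one pulled back along it. A countable basis can then be pulled back too.\<close>

lemma open_rsphere_iff_stereo: "open U \<longleftrightarrow> (\<exists>V. open V \<and> U = stereo -` V)"
proof
  assume "open U"
  then obtain V where V: "open V" "V \<inter> sphere 0 1 = inv stereo -` U \<inter> sphere 0 1"
    using continuous_on_inv_stereo[unfolded continuous_on_open_invariant, rule_format, OF \<open>open U\<close>]
    by (elim exE conjE)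
  have "x \<in> U \<longleftrightarrow> stereo x \<in> V" for x
  proof -
    have "stereo x \<in> V \<inter> sphere 0 1 \<longleftrightarrow> stereo x \<in> inv stereo -` U \<inter> sphere 0 1"
      by (simp only: V(2))
    then show ?thesis by (simp add: norm_stereo inj_stereo)
  qed
  then show "\<exists>V. open V \<and> U = stereo -` V" using V(1) by blast
next
  assume "\<exists>V. open V \<and> U = stereo -` V"
  then show "open U"
    using open_vimage[OF _ continuous_on_stereo[OF continuous_on_id, of UNIV]] by auto
qed

instance rsphere :: second_countable_topology
proof
  obtain B :: "(complex \<times> real) set set" where B: "countable B" "topological_basis B"
    using ex_countable_basis by blast
  have "topological_basis ((\<lambda>V. stereo -` V) ` B)"
  proof (rule topological_basisI)
    show "open U" if "U \<in> (\<lambda>V. stereo -` V) ` B" for U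
      using that B(2) topological_basis_open open_rsphere_iff_stereo by blast
    fix O' :: "rsphere set" and x assume "open O'" "x \<in> O'"
    then obtain V where V: "open V" "O' = stereo -` V" "stereo x \<in> V"
      using open_rsphere_iff_stereo by auto
    obtain W where "W \<in> B" "stereo x \<in> W" "W \<subseteq> V"
      using topological_basisE[OF B(2) V(1,3)] .
    then show "\<exists>B'\<in>(\<lambda>V. stereo -` V) ` B. x \<in> B' \<and> B' \<subseteq> O'"
      using V by blast
  qed
  then show "\<exists>B::rsphere set set. countable B \<and> open = generate_topology B"
    using B(1) topological_basis_imp_subbasis by blast
qed

lemma continuous_on_Fin: "continuous_on S Fin"
proof -
  have "isCont Fin z" for z
    unfolding isCont_def tendsto_rsphere_iff stereo.simps
    by (intro tendsto_intros) (simp_all add: add_nonneg_eq_0_iff)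
  then show ?thesis by (simp add: continuous_at_imp_continuous_on)
qed

section \<open>Neighbourhoods of infinity\<close>

definition near_infty :: "real \<Rightarrow> rsphere set" where
  "near_infty R = {x. \<forall>w. x = Fin w \<longrightarrow> R < cmod w}"

lemma near_infty_simps [simp]: "Infty \<in> near_infty R" "Fin w \<in> near_infty R \<longleftrightarrow> R < cmod w"
  by (auto simp: near_infty_def)

text \<open>For \<open>t \<ge> 0\<close> the function \<open>(t - 1) / (t + 1)\<close> increases, so
  comparing moduli amounts to comparing heights on the unit sphere. This makes
  \<open>near_infty R\<close> an open spherical cap.\<close>

lemma height_less_iff:
  fixes a b :: real
  assumes "0 \<le> a" "0 \<le> b"
  shows "(a\<^sup>2 - 1) / (a\<^sup>2 + 1) < (b\<^sup>2 - 1) / (b\<^sup>2 + 1) \<longleftrightarrow> a < b"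
proof -
  have pos: "0 < a\<^sup>2 + 1" "0 < b\<^sup>2 + 1" by (simp_all add: add_nonneg_pos)
  then have "(a\<^sup>2 - 1) / (a\<^sup>2 + 1) < (b\<^sup>2 - 1) / (b\<^sup>2 + 1) \<longleftrightarrow> a\<^sup>2 < b\<^sup>2"
    by (auto simp: divide_simps algebra_simps)
  also have "\<dots> \<longleftrightarrow> a < b" using assms by (auto intro: power_less_imp_less_base power_strict_mono)
  finally show ?thesis .
qed

lemma near_infty_eq_height:
  assumes "0 \<le> R"
  shows "near_infty R = {x. (R\<^sup>2 - 1) / (R\<^sup>2 + 1) < snd (stereo x)}"
proof (rule set_eqI)
  fix x show "x \<in> near_infty R \<longleftrightarrow> x \<in> {x. (R\<^sup>2 - 1) / (R\<^sup>2 + 1) < snd (stereo x)}"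
  proof (cases x)
    case (Fin w) then show ?thesis using assms by (simp add: height_less_iff)
  next
    case Infty
    have "(R\<^sup>2 - 1) / (R\<^sup>2 + 1) < 1" by (simp add: divide_simps add_nonneg_pos)
    then show ?thesis using Infty by simp
  qed
qed

lemma open_near_infty: "open (near_infty R)"
proof (cases "0 \<le> R")
  case True
  show ?thesis unfolding near_infty_eq_height[OF True]
    by (intro open_Collect_less continuous_intros)
next
  case False
  then have "near_infty R = UNIV"
    by (auto simp: near_infty_def) (smt (verit) norm_ge_zero)
  then show ?thesis by simp
qed

text \<open>The squared chord from \<open>Fin w\<close> to \<open>Infty\<close> is
  \<open>4 / ((cmod w)\<^sup>2 + 1)\<close>, so the sets \<open>near_infty R\<close> shrink to
  \<open>Infty\<close> as \<open>R\<close> grows.\<close>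

lemma tendsto_Infty_iff:
  "(f \<longlongrightarrow> Infty) F \<longleftrightarrow> (\<forall>R. eventually (\<lambda>x. f x \<in> near_infty R) F)"
proof
  assume "(f \<longlongrightarrow> Infty) F"
  then show "\<forall>R. eventually (\<lambda>x. f x \<in> near_infty R) F"
    using open_near_infty by (simp add: topological_tendstoD)
next
  assume *: "\<forall>R. eventually (\<lambda>x. f x \<in> near_infty R) F"
  have "norm (stereo x - stereo Infty) \<le> e" if e: "0 < e" and x: "x \<in> near_infty (2 / e)" for e x
  proof (cases x)
    case (Fin w)
    then have w: "2 / e < cmod w" using x by simp
    have "cmod w > 0" using w e by (smt (verit) divide_pos_pos)
    have "(norm (stereo x - stereo Infty))\<^sup>2 = 2 - 2 * (stereo x \<bullet> stereo Infty)"
      unfolding norm_stereo_diff inner_stereo by (rule real_sqrt_pow2) simp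
    also have "\<dots> = 2 - 2 * (((cmod w)\<^sup>2 - 1) / ((cmod w)\<^sup>2 + 1))"
      by (simp add: Fin)
    also have "\<dots> = 4 / ((cmod w)\<^sup>2 + 1)"
    proof -
      have "(cmod w)\<^sup>2 + 1 \<noteq> 0" by (smt (verit) zero_le_power2)
      then show ?thesis by (simp add: divide_simps algebra_simps)
    qed
    also have "\<dots> \<le> 4 / (cmod w)\<^sup>2"
      using \<open>cmod w > 0\<close> by (intro divide_left_mono) (auto intro!: mult_pos_pos add_pos_pos)
    also have "\<dots> = (2 / cmod w)\<^sup>2" by (simp add: power_divide)
    also have "\<dots> \<le> e\<^sup>2"
      using w e \<open>cmod w > 0\<close> by (intro power_mono) (auto simp: field_simps)
    finally show ?thesis using e by (simp add: power2_le_iff_abs_le)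
  qed (use e in simp)
  then have "norm (stereo x - stereo Infty) < e" if "0 < e" "x \<in> near_infty (2 / (e / 2))" for e x
    using that by (smt (verit) half_gt_zero field_sum_of_halves)
  then have "eventually (\<lambda>x. norm (stereo (f x) - stereo Infty) < e) F" if "0 < e" for e
    using * that by (blast intro: eventually_mono)
  then show "(f \<longlongrightarrow> Infty) F"
    unfolding tendsto_rsphere_iff by (simp add: tendsto_iff dist_norm)
qed

section \<open>The space of polynomial maps\<close>

lemma height_Fin_less_1: "((cmod z)\<^sup>2 - 1) / ((cmod z)\<^sup>2 + 1) < 1"
  by (simp add: divide_simps add_nonneg_pos)

text \<open>Stereographic projection recovers the affine coordinate as a continuous function of
  \<open>stereo\<close>. On the finite plane a polynomial map is thus a composition of known
  continuous functions.\<close>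

lemma Fin_coordinate:
  "(1 / (1 - snd (stereo (Fin z)))) *\<^sub>R fst (stereo (Fin z)) = z"
proof -
  define s where "s = (cmod z)\<^sup>2"
  have "0 \<le> s" by (simp add: s_def)
  then have "1 - (s - 1) / (s + 1) = 2 / (1 + s)" by (simp add: divide_simps)
  then have "1 / (1 - (s - 1) / (s + 1)) * (2 / (1 + s)) = 1" using \<open>0 \<le> s\<close> by simp
  then show ?thesis by (simp only: stereo.simps fst_conv snd_conv scaleR_scaleR s_def scaleR_one)
qed

lemma apply_polymap_cases:
  obtains p where "2 \<le> degree p" "apply_polymap f = poly_sphere p"
  using apply_polymap[of f] by blast

text \<open>At finite points the affine coordinate gives continuity. At \<open>Infty\<close>
  continuity says that \<open>cmod (poly p w)\<close> tends to infinity with \<open>cmod w\<close>,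
  which is where non-constancy enters.\<close>

lemma continuous_poly_sphere:
  assumes "degree p \<noteq> 0"
  shows "continuous_on UNIV (poly_sphere p)"
proof -
  have "isCont (poly_sphere p) x" for x
  proof (cases x)
    case (Fin z)
    have eq: "- {Infty} = range Fin" using rsphere.exhaust by auto
    have "continuous_on (- {Infty}) (\<lambda>x. Fin (poly p ((1 / (1 - snd (stereo x))) *\<^sub>R fst (stereo x))))"
      unfolding eq using height_Fin_less_1
      by (intro continuous_on_compose2[OF continuous_on_Fin[of UNIV]] continuous_intros)
        (auto simp del: stereo.simps(1), metis less_irrefl snd_conv stereo.simps(1))
    then have "continuous_on (- {Infty}) (poly_sphere p)"
      by (rule continuous_on_eq) (use eq in \<open>auto simp only: Fin_coordinate poly_sphere.simps\<close>)
    then show ?thesis using Fin by (simp add: continuous_on_eq_continuous_at[OF open_Compl])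
  next
    case Infty
    obtain a q where p: "p = pCons a q" "q \<noteq> 0"
      using assms by (cases p) (auto split: if_splits)
    have "eventually (\<lambda>y. poly_sphere p y \<in> near_infty R) (at Infty)" for R
    proof -
      obtain r where r: "\<And>w. r \<le> cmod w \<Longrightarrow> R + 1 \<le> cmod (poly p w)"
        using poly_infinity[OF p(2)] unfolding p(1) by blast
      have "y \<in> near_infty r \<Longrightarrow> poly_sphere p y \<in> near_infty R" for y
      proof (cases y)
        case (Fin w)
        then show "y \<in> near_infty r \<Longrightarrow> poly_sphere p y \<in> near_infty R"
          using r[of w] by simp
      qed simp
      moreover have "eventually (\<lambda>y. y \<in> near_infty r) (at Infty)"
        unfolding eventually_at_topological
        by (intro exI[of _ "near_infty r"]) (simp add: open_near_infty)
      ultimately show ?thesis by (blast intro: eventually_mono)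
    qed
    then show ?thesis using Infty by (simp add: isCont_def tendsto_Infty_iff)
  qed
  then show ?thesis by (simp add: continuous_at_imp_continuous_on)
qed

lemma continuous_apply_polymap: "continuous_on S (apply_polymap f)"
proof -
  obtain p where "2 \<le> degree p" "apply_polymap f = poly_sphere p"
    by (rule apply_polymap_cases[of f])
  then show ?thesis
    using continuous_on_subset[OF continuous_poly_sphere[of p] subset_UNIV] by auto
qed

lemma dist_apply_polymap_le: "dist (apply_polymap f x) (apply_polymap g x) \<le> dist f g"
  unfolding dist_polymap_def by (rule cSUP_upper[OF UNIV_I bdd_above_dist_rsphere])

text \<open>The metric on \<open>polymap\<close> is uniform over the sphere, so changing the map
  costs at most the distance of the maps at every point, and moving the point is controlled by
  continuity of the fixed \<open>f\<close>. Measurability of random orbits rests on this.\<close>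

lemma isCont_eval_polymap: "isCont (\<lambda>(f, x). apply_polymap f x) p"
proof -
  obtain f x where p: "p = (f, x)" by (cases p)
  have "((\<lambda>q. dist (apply_polymap (fst q) (snd q)) (apply_polymap f x)) \<longlongrightarrow> 0) (at p)"
  proof (rule tendsto_sandwich[where f = "\<lambda>_. 0" and
        h = "\<lambda>q. dist (fst q) f + dist (apply_polymap f (snd q)) (apply_polymap f x)"])
    have fst: "(fst \<longlongrightarrow> f) (at p)" and snd: "(snd \<longlongrightarrow> x) (at p)"
      using tendsto_fst[OF tendsto_ident_at, of p UNIV] tendsto_snd[OF tendsto_ident_at, of p UNIV]
      by (simp_all add: p)
    have "isCont (apply_polymap f) x"
      using continuous_apply_polymap[of UNIV f] by (simp add: continuous_on_eq_continuous_at)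
    then have "((\<lambda>q. dist (fst q) f + dist (apply_polymap f (snd q)) (apply_polymap f x))
        \<longlongrightarrow> dist f f + dist (apply_polymap f x) (apply_polymap f x)) (at p)"
      by (intro tendsto_add tendsto_dist fst tendsto_const isCont_tendsto_compose[OF _ snd])
    then show "((\<lambda>q. dist (fst q) f + dist (apply_polymap f (snd q)) (apply_polymap f x))
        \<longlongrightarrow> 0) (at p)" by simp
    show "\<forall>\<^sub>F q in at p. dist (apply_polymap (fst q) (snd q)) (apply_polymap f x)
        \<le> dist (fst q) f + dist (apply_polymap f (snd q)) (apply_polymap f x)"
    proof (intro always_eventually allI)
      fix q
      show "dist (apply_polymap (fst q) (snd q)) (apply_polymap f x)
          \<le> dist (fst q) f + dist (apply_polymap f (snd q)) (apply_polymap f x)"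
        using dist_apply_polymap_le[of "fst q" "snd q" f]
          dist_triangle[of "apply_polymap (fst q) (snd q)" "apply_polymap f x" "apply_polymap f (snd q)"]
        by linarith
    qed
  qed simp_all
  then show ?thesis
    unfolding isCont_def case_prod_beta by (subst tendsto_dist_iff) (simp add: p)
qed

text \<open>The sets of maps described by \<open>l\<close> need not be open, but there are only countably many of
  them, and picking a point in each nonempty one gives a countable dense set.\<close>

lemma polymap_network:
  assumes \<B>: "topological_basis (\<B> :: rsphere set set)" and e: "0 < e"
  obtains l where "set l \<subseteq> \<B> \<times> \<B>" "\<forall>(B, V)\<in>set l. apply_polymap f ` B \<subseteq> V"
    "\<And>g. \<forall>(B, V)\<in>set l. apply_polymap g ` B \<subseteq> V \<Longrightarrow> dist f g < e"
proof -
  have "\<exists>P\<in>\<B> \<times> \<B>. x \<in> fst P \<and> apply_polymap f ` fst P \<subseteq> snd P \<and>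
      snd P \<subseteq> ball (apply_polymap f x) (e / 4)" for x
  proof -
    obtain V where V: "V \<in> \<B>" "apply_polymap f x \<in> V" "V \<subseteq> ball (apply_polymap f x) (e / 4)"
      by (rule topological_basisE[OF \<B> open_ball, of "apply_polymap f x" "apply_polymap f x" "e / 4"])
        (use e in simp)
    have "open (apply_polymap f -` V)" "x \<in> apply_polymap f -` V"
      using V(2) by (simp_all add: open_vimage[OF topological_basis_open[OF \<B> V(1)] continuous_apply_polymap])
    then obtain B where "B \<in> \<B>" "x \<in> B" "B \<subseteq> apply_polymap f -` V"
      by (rule topological_basisE[OF \<B>])
    then show ?thesis using V by (intro bexI[of _ "(B, V)"]) auto
  qed
  then have "\<exists>P. \<forall>x. P x \<in> \<B> \<times> \<B> \<and> x \<in> fst (P x) \<and> apply_polymap f ` fst (P x) \<subseteq> snd (P x) \<and>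
      snd (P x) \<subseteq> ball (apply_polymap f x) (e / 4)"
    unfolding Bex_def by (intro choice allI)
  then obtain P where "\<forall>x. P x \<in> \<B> \<times> \<B> \<and> x \<in> fst (P x) \<and>
      apply_polymap f ` fst (P x) \<subseteq> snd (P x) \<and> snd (P x) \<subseteq> ball (apply_polymap f x) (e / 4)"
    by (elim exE)
  then have P: "P x \<in> \<B> \<times> \<B>" "x \<in> fst (P x)" "apply_polymap f ` fst (P x) \<subseteq> snd (P x)"
      "snd (P x) \<subseteq> ball (apply_polymap f x) (e / 4)" for x
    by simp_all
  have "open (fst (P x))" for x
    using P(1)[of x] topological_basis_open[OF \<B>] by (simp add: mem_Times_iff)
  then obtain X where X: "finite X" "UNIV \<subseteq> (\<Union>x\<in>X. fst (P x))"
  proof (rule compactE_image[OF compact_UNIV_rsphere, of UNIV "\<lambda>x. fst (P x)"])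
    show "UNIV \<subseteq> (\<Union>x. fst (P x))" using P(2) by blast
  qed
  obtain l where l: "set l = P ` X" using finite_list[OF finite_imageI[OF X(1)], of P] by (elim exE)
  show thesis
  proof
    show "set l \<subseteq> \<B> \<times> \<B>" unfolding l by (intro image_subsetI P(1))
    show "\<forall>(B, V)\<in>set l. apply_polymap f ` B \<subseteq> V" using P(3) unfolding l by (simp add: case_prod_beta)
    fix g assume g: "\<forall>(B, V)\<in>set l. apply_polymap g ` B \<subseteq> V"
    \<comment> \<open>Both images of \<open>y\<close> lie in one ball of radius
      \<open>e / 4\<close>. The bound \<open>e / 2\<close> then passes to the supremum and still
      leaves a strict bound by \<open>e\<close>.\<close>
    have "dist (apply_polymap f y) (apply_polymap g y) \<le> e / 2" for y
    proof -
      obtain x where x: "x \<in> X" "y \<in> fst (P x)" using X(2) by blast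
      have "\<forall>z\<in>fst (P x). apply_polymap g z \<in> snd (P x)" using g x(1) unfolding l by (simp add: case_prod_beta image_subset_iff)
      then have "apply_polymap g y \<in> snd (P x)" using x(2) by (rule bspec)
      moreover have "apply_polymap f y \<in> snd (P x)"
        by (rule subsetD[OF P(3)]) (rule imageI[OF x(2)])
      ultimately have "apply_polymap g y \<in> ball (apply_polymap f x) (e / 4)"
        "apply_polymap f y \<in> ball (apply_polymap f x) (e / 4)"
        using P(4)[of x] by (simp_all only: subset_iff)
      then show ?thesis
        using dist_triangle3[of "apply_polymap f y" "apply_polymap g y" "apply_polymap f x"] by simp
    qed
    then have "dist f g \<le> e / 2" unfolding dist_polymap_def by (intro cSUP_least) auto
    then show "dist f g < e" using e by simp
  qed
qed

lemma countable_dense_polymap: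
  obtains D :: "polymap set" where "countable D" "\<And>f e. 0 < e \<Longrightarrow> \<exists>d\<in>D. dist f d < e"
proof -
  obtain \<B> :: "rsphere set set" where \<B>: "countable \<B>" "topological_basis \<B>"
    using ex_countable_basis by blast
  define N where "N l = {g. \<forall>(B, V)\<in>set l. apply_polymap g ` B \<subseteq> V}" for l
  \<comment> \<open>For empty \<open>N l\<close> this is an arbitrary map; below it is used only
    when some \<open>f\<close> lies in \<open>N l\<close>.\<close>
  define c where "c l = (SOME g. g \<in> N l)" for l
  show thesis
  proof
    show "countable (c ` lists (\<B> \<times> \<B>))" using \<B>(1) by simp
    fix f :: polymap and e :: real assume e: "0 < e"
    obtain l where l: "set l \<subseteq> \<B> \<times> \<B>" "\<forall>(B, V)\<in>set l. apply_polymap f ` B \<subseteq> V"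
      "\<And>g. \<forall>(B, V)\<in>set l. apply_polymap g ` B \<subseteq> V \<Longrightarrow> dist f g < e"
      by (rule polymap_network[OF \<B>(2) e, of f]; rule that; assumption?; blast)
    have "f \<in> N l" using l(2) by (simp add: N_def)
    then have "c l \<in> N l" unfolding c_def by (rule someI)
    then have "dist f (c l) < e" unfolding N_def by (intro l(3)) simp
    then show "\<exists>d\<in>c ` lists (\<B> \<times> \<B>). dist f d < e" 
      using l(1) by (intro bexI[of _ "c l"] imageI) auto
  qed
qed

text \<open>Balls of radii \<open>1 / Suc n\<close> around a countable dense set form a basis.
  Second countability makes evaluation measurable for the product of the Borel algebras and gives
  the support full measure.\<close>

instance polymap :: second_countable_topology
proof
  obtain D :: "polymap set" where D: "countable D" "\<And>f e. 0 < e \<Longrightarrow> \<exists>d\<in>D. dist f d < e"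
    by (rule countable_dense_polymap; rule that; blast)
  have "topological_basis ((\<lambda>(d, n). ball d (1 / Suc n)) ` (D \<times> UNIV))"
  proof (rule topological_basisI)
    fix U :: "polymap set" and f assume "open U" "f \<in> U"
    then obtain e where e: "0 < e" "ball f e \<subseteq> U" using open_contains_ball by blast
    obtain n where n: "1 / Suc n < e / 2" by (rule nat_approx_posE[of "e / 2"]) (use e(1) in auto)
    have "0 < 1 / real (Suc n)" by simp
    then obtain d where d: "d \<in> D" "dist f d < 1 / Suc n" using D(2) by blast
    have "ball d (1 / Suc n) \<subseteq> ball f e"
    proof
      fix g assume "g \<in> ball d (1 / Suc n)"
      then show "g \<in> ball f e" using d(2) n dist_triangle[of f g d] by simp
    qed
    then have "ball d (1 / Suc n) \<subseteq> U" using e(2) by (rule order_trans)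
    moreover have "f \<in> ball d (1 / Suc n)" using d(2) by (simp add: dist_commute)
    moreover have "ball d (1 / Suc n) \<in> (\<lambda>(d, n). ball d (1 / Suc n)) ` (D \<times> UNIV)"
      using d(1) by (intro image_eqI[of _ _ "(d, n)"]) simp_all
    ultimately show "\<exists>B\<in>(\<lambda>(d, n). ball d (1 / Suc n)) ` (D \<times> UNIV). f \<in> B \<and> B \<subseteq> U"
      by (intro bexI conjI)
  qed (simp add: case_prod_beta image_iff, metis open_ball)
  moreover have "countable ((\<lambda>(d, n). ball d (1 / Suc n)) ` (D \<times> (UNIV :: nat set)))"
    using D(1) by (intro countable_image countable_SIGMA) simp_all
  ultimately show "\<exists>B::polymap set set. countable B \<and> open = generate_topology B"
    by (intro exI conjI topological_basis_imp_subbasis)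
qed

text \<open>A point outside the support has a null open neighbourhood, hence a null basic one, and
  there are only countably many basic sets.\<close>

lemma AE_supp:
  fixes \<mu> :: "'a::second_countable_topology measure"
  assumes sets: "sets \<mu> = sets borel"
  shows "AE x in \<mu>. x \<in> supp \<mu>"
proof -
  obtain \<B> :: "'a set set" where \<B>: "countable \<B>" "topological_basis \<B>"
    using ex_countable_basis by blast
  define N where "N = {U \<in> \<B>. emeasure \<mu> U = 0}"
  have "\<Union>N \<in> null_sets \<mu>"
  proof (rule null_sets_UN'[of N id, simplified])
    show "countable N" using \<B>(1) by (simp add: N_def)
    show "U \<in> null_sets \<mu>" if "U \<in> N" for U
      using that \<B>(2) by (simp add: N_def null_sets_def sets topological_basis_open)
  qed
  moreover have "{x \<in> space \<mu>. x \<notin> supp \<mu>} \<subseteq> \<Union>N"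
  proof
    fix x assume "x \<in> {x \<in> space \<mu>. x \<notin> supp \<mu>}"
    then obtain U where U: "open U" "x \<in> U" "emeasure \<mu> U = 0"
      by (auto simp: supp_def)
    obtain B where B: "B \<in> \<B>" "x \<in> B" "B \<subseteq> U"
      using topological_basisE[OF \<B>(2) U(1,2)] .
    have "emeasure \<mu> B \<le> emeasure \<mu> U"
      using B(3) U(1) by (intro emeasure_mono) (simp_all add: sets)
    then show "x \<in> \<Union>N" using U(3) B by (auto simp: N_def)
  qed
  ultimately show ?thesis by (rule AE_I')
qed

section \<open>Uniform expansion near infinity\<close>

text \<open>The maximum modulus principle for \<open>w / q w\<close> in the coordinate \<open>u = 1 / w\<close>, where
  \<open>q (1 / u) = reflect_poly q u / u ^ degree q\<close>.\<close>

lemma poly_exterior_bound: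
  fixes q :: "complex poly"
  assumes q: "2 \<le> degree q" and R: "0 < R"
    and le: "\<And>w. R \<le> cmod w \<Longrightarrow> 2 * R \<le> cmod (poly q w)"
    and w: "R \<le> cmod w"
  shows "2 * cmod w \<le> cmod (poly q w)"
proof -
  define h where "h u = u ^ (degree q - 1) / poly (reflect_poly q) u" for u
  have h: "h u = inverse u / poly q (inverse u)" if "u \<noteq> 0" for u
  proof -
    have "u ^ degree q = u * u ^ (degree q - 1)" using q by (cases "degree q") auto
    then show ?thesis using that by (simp add: h_def poly_reflect_poly_nz inverse_eq_divide)
  qed
  have inv: "R \<le> cmod (inverse u)" if "u \<in> cball 0 (1 / R)" "u \<noteq> 0" for u
    using that R by (simp add: norm_inverse) (simp add: field_simps)
  have nz: "poly (reflect_poly q) u \<noteq> 0" if u: "u \<in> cball 0 (1 / R)" for u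
  proof (cases "u = 0")
    \<comment> \<open>At \<open>0\<close> the reflected polynomial takes the leading coefficient of
      \<open>q\<close>.\<close>
    case True
    then show ?thesis using q by (auto simp: reflect_poly_at_0_eq_0_iff)
  next
    case False
    then have "poly q (inverse u) \<noteq> 0" using le[OF inv[OF u]] R by auto
    then show ?thesis using False by (simp add: poly_reflect_poly_nz)
  qed
  have "cmod (h (inverse w)) \<le> 1 / 2"
  proof (rule maximum_modulus_frontier[of h "cball 0 (1 / R)"])
    show "h holomorphic_on interior (cball 0 (1 / R))"
      unfolding h_def using nz interior_subset by (intro holomorphic_intros) blast
    show "continuous_on (closure (cball 0 (1 / R))) h"
      unfolding h_def using nz by (intro continuous_intros) auto
    have "inverse (cmod w) \<le> inverse R" using w R by (simp add: le_imp_inverse_le)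
    then show "inverse w \<in> cball 0 (1 / R)" by (simp add: norm_divide inverse_eq_divide)
    \<comment> \<open>On the boundary circle \<open>inverse u\<close> has modulus exactly
      \<open>R\<close>, so the hypothesis \<open>le\<close> bounds the quotient by
      \<open>1 / 2\<close>.\<close>
    fix u :: complex assume "u \<in> frontier (cball 0 (1 / R))"
    then have u: "cmod u = 1 / R" "u \<noteq> 0" using R by auto
    then have "2 * R \<le> cmod (poly q (inverse u))" using R by (intro le) (simp add: norm_inverse)
    moreover have "cmod (h u) = R / cmod (poly q (inverse u))"
      using u by (simp add: h norm_divide norm_inverse)
    ultimately show "cmod (h u) \<le> 1 / 2" using R by (simp add: divide_le_eq)
  qed simp
  moreover have "0 < cmod w" "0 < cmod (poly q w)" using w R le[OF w] by linarith+
  ultimately show ?thesis by (simp add: h norm_divide divide_simps)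
qed

text \<open>Writing \<open>p\<close> as \<open>a + w * q w\<close> with \<open>q\<close>
  non-constant, the factor \<open>q\<close> eventually has modulus at least \<open>4\<close>; once
  \<open>cmod a \<le> cmod w\<close>, the constant term costs at most one multiple of
  \<open>cmod w\<close>.\<close>

lemma poly_superlinear:
  fixes p :: "complex poly"
  assumes "2 \<le> degree p"
  obtains R where "1 \<le> R" "\<And>w. R \<le> cmod w \<Longrightarrow> 3 * cmod w \<le> cmod (poly p w)"
proof -
  obtain a q where p: "p = pCons a q" by (cases p)
  then have "1 \<le> degree q" using assms by (auto split: if_splits)
  moreover obtain b q' where q: "q = pCons b q'" by (cases q)
  ultimately have "q' \<noteq> 0" by auto
  then obtain r where r: "\<And>w. r \<le> cmod w \<Longrightarrow> 4 \<le> cmod (poly q w)"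
    using poly_infinity unfolding q by blast
  show thesis
  proof
    fix w assume w: "max 1 (max r (cmod a)) \<le> cmod w"
    have "4 * cmod w \<le> cmod (w * poly q w)"
      using mult_left_mono[OF r, of w "cmod w"] w by (simp add: norm_mult mult.commute)
    then show "3 * cmod w \<le> cmod (poly p w)"
      using norm_diff_ineq[of "w * poly q w" a] w by (simp add: p add.commute)
  qed simp
qed

text \<open>Closeness in the spherical metric gives no multiplicative control of \<open>f w\<close> for large \<open>w\<close>; it
  only keeps \<open>f w\<close> outside a disc, and \<open>poly_exterior_bound\<close> upgrades this to linear growth.\<close>

lemma polymap_locally_expanding:
  obtains e R where "0 < e" "1 \<le> R"
    "\<And>f w. dist f f\<^sub>0 < e \<Longrightarrow> R \<le> cmod w \<Longrightarrow> \<exists>u. apply_polymap f (Fin w) = Fin u \<and> 2 * cmod w \<le> cmod u"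
proof -
  obtain p where p: "2 \<le> degree p" "apply_polymap f\<^sub>0 = poly_sphere p"
    by (rule apply_polymap_cases[of f\<^sub>0])
  obtain R where R: "1 \<le> R" "\<And>w. R \<le> cmod w \<Longrightarrow> 3 * cmod w \<le> cmod (poly p w)"
    by (rule poly_superlinear[OF p(1)]; rule that; blast)
  \<comment> \<open>The closed exterior of the disc of radius \<open>3 * R\<close>, with
    \<open>Infty\<close>, described by height so that it is visibly closed. Its compactness yields a
    margin \<open>e\<close> within \<open>near_infty (2 * R)\<close>.\<close>
  define K where "K = {x. ((3 * R)\<^sup>2 - 1) / ((3 * R)\<^sup>2 + 1) \<le> snd (stereo x)}"
  have K: "Fin w \<in> K \<longleftrightarrow> 3 * R \<le> cmod w" for w
    using height_less_iff[of "cmod w" "3 * R"] R(1) by (simp add: K_def not_less[symmetric])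
  have "closed K" unfolding K_def by (intro closed_Collect_le continuous_intros)
  then have "compact K" using closed_Int_compact[OF _ compact_UNIV_rsphere] by simp
  moreover have "K \<subseteq> near_infty (2 * R)"
  proof
    fix x assume "x \<in> K" then show "x \<in> near_infty (2 * R)"
      using R(1) by (cases x) (simp_all add: K)
  qed
  ultimately obtain e where e: "0 < e" "(\<Union>x\<in>K. ball x e) \<subseteq> near_infty (2 * R)"
    by (rule compact_subset_open_imp_ball_epsilon_subset[OF _ open_near_infty])
  show thesis
  proof
    fix f w assume f: "dist f f\<^sub>0 < e" and w: "R \<le> cmod w"
    obtain q where q: "2 \<le> degree q" "apply_polymap f = poly_sphere q"
      by (rule apply_polymap_cases[of f])
    \<comment> \<open>The bound is required at every \<open>v\<close> outside the disc, not only at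
      \<open>w\<close>, because the maximum modulus argument uses the whole exterior.\<close>
    have "2 * R \<le> cmod (poly q v)" if v: "R \<le> cmod v" for v
    proof -
      have "3 * R \<le> cmod (poly p v)" using R(2)[OF v] v by simp
      then have "apply_polymap f\<^sub>0 (Fin v) \<in> K" by (simp add: p K)
      moreover have "dist (apply_polymap f\<^sub>0 (Fin v)) (apply_polymap f (Fin v)) < e"
        using dist_apply_polymap_le[of f\<^sub>0 "Fin v" f] f by (simp add: dist_commute)
      ultimately have "apply_polymap f (Fin v) \<in> near_infty (2 * R)"
        by (intro subsetD[OF e(2)] UN_I[of "apply_polymap f\<^sub>0 (Fin v)"]) simp_all
      then show ?thesis by (simp add: q)
    qed
    then show "\<exists>u. apply_polymap f (Fin w) = Fin u \<and> 2 * cmod w \<le> cmod u"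
      using poly_exterior_bound[OF q(1) _ _ w] R(1) by (simp add: q)
  qed (use e R in auto)
qed

text \<open>Finitely many of the local balls cover \<open>S\<close>, and the largest of their radii
  serves all of it.\<close>

lemma compact_polymaps_expanding:
  assumes "compact S"
  obtains R where "1 \<le> R"
    "\<And>f w. f \<in> S \<Longrightarrow> R \<le> cmod w \<Longrightarrow> \<exists>u. apply_polymap f (Fin w) = Fin u \<and> 2 * cmod w \<le> cmod u"
proof -
  have "\<exists>e R. 0 < e \<and> 1 \<le> R \<and> (\<forall>f w. dist f f\<^sub>0 < e \<longrightarrow> R \<le> cmod w \<longrightarrow>
      (\<exists>u. apply_polymap f (Fin w) = Fin u \<and> 2 * cmod w \<le> cmod u))" for f\<^sub>0
    by (rule polymap_locally_expanding[of f\<^sub>0]) blast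
  then obtain e R where eR: "\<And>f\<^sub>0. 0 < e f\<^sub>0" "\<And>f\<^sub>0. 1 \<le> R f\<^sub>0"
      "\<And>f\<^sub>0 f w. dist f f\<^sub>0 < e f\<^sub>0 \<Longrightarrow> R f\<^sub>0 \<le> cmod w \<Longrightarrow>
        \<exists>u. apply_polymap f (Fin w) = Fin u \<and> 2 * cmod w \<le> cmod u"
    by metis
  obtain X where X: "finite X" "S \<subseteq> (\<Union>f\<in>X. ball f (e f))"
    by (rule compactE_image[OF assms, of S "\<lambda>f. ball f (e f)"]) (use eR(1) in auto)
  show thesis
  proof
    fix f w assume f: "f \<in> S" and w: "Max (insert 1 (R ` X)) \<le> cmod w"
    obtain g where "g \<in> X" "dist f g < e g" using X(2) f by (auto simp: dist_commute)
    moreover have "R g \<le> cmod w" using \<open>g \<in> X\<close> X(1) w by simp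
    ultimately show "\<exists>u. apply_polymap f (Fin w) = Fin u \<and> 2 * cmod w \<le> cmod u"
      using eR(3) by blast
  qed (use X(1) in simp)
qed

section \<open>Random orbits and the probability of escape\<close>

lemma measurable_apply_polymap [measurable (raw)]:
  assumes "f \<in> borel_measurable M" "g \<in> borel_measurable M"
  shows "(\<lambda>x. apply_polymap (f x) (g x)) \<in> borel_measurable M"
proof -
  have "(\<lambda>(f, x). apply_polymap f x) \<in> borel_measurable borel"
    using isCont_eval_polymap
    by (intro borel_measurable_continuous_onI continuous_at_imp_continuous_on) blast
  then have "(\<lambda>(f, x). apply_polymap f x) \<in> borel_measurable (borel \<Otimes>\<^sub>M borel)"
    by (simp add: borel_prod)
  from measurable_compose[OF measurable_Pair[OF assms] this] show ?thesis by simp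
qed

text \<open>A prepended map acts first on the point. This links the shift on sequences to the
  operator \<open>M_op\<close>.\<close>

lemma random_orbit_case_nat:
  "random_orbit (case_nat f \<gamma>) (Suc n) z = random_orbit \<gamma> n (apply_polymap f z)"
  by (induction n) auto

text \<open>The index is \<open>Suc n\<close> because the orbit map at time \<open>0\<close> is the
  identity, which the generated semigroup need not contain.\<close>

lemma random_orbit_in_semigroup:
  assumes "\<And>n. \<gamma> n \<in> supp \<tau>"
  shows "random_orbit \<gamma> (Suc n) \<in> semigroup_of \<tau>"
proof (induction n)
  case 0
  then show ?case using assms by (auto simp: semigroup_of_def intro: generated_semigroup.gen)
next
  case (Suc n)
  have "apply_polymap (\<gamma> (Suc n)) \<in> semigroup_of \<tau>"
    using assms by (auto simp: semigroup_of_def intro: generated_semigroup.gen)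
  then show ?case
    using Suc unfolding semigroup_of_def random_orbit.simps(2)[of \<gamma> "Suc n"]
    by (rule generated_semigroup.comp)
qed

locale random_polymaps = prob_space \<tau> for \<tau> :: "polymap measure" +
  assumes sets_eq [measurable_cong]: "sets \<tau> = sets borel"
    and compact_supp: "compact (supp \<tau>)"
begin

lemma prob_space_tau: "prob_space \<tau>"
  by unfold_locales

sublocale sequence_space \<tau> ..

lemma space_eq [simp]: "space \<tau> = UNIV"
  using sets_eq_imp_space_eq[OF sets_eq] by simp

lemma space_S [simp]: "space S = UNIV"
  by (simp add: space_PiM)

definition escapes :: "(nat \<Rightarrow> polymap) \<Rightarrow> rsphere \<Rightarrow> bool" where
  "escapes \<gamma> z \<longleftrightarrow> (\<lambda>n. random_orbit \<gamma> n z) \<longlonglongrightarrow> Infty"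

lemma T_infty_eq: "T_infty \<tau> z = measure S {\<gamma>. escapes \<gamma> z}"
  by (simp add: T_infty_def escapes_def)

lemma measurable_random_orbit [measurable]:
  "(\<lambda>p. random_orbit (snd p) n (fst p)) \<in> borel_measurable (borel \<Otimes>\<^sub>M S)"
proof (induction n)
  case 0
  then show ?case by simp
next
  case (Suc n)
  have "(\<lambda>p. snd p n) \<in> measurable (borel \<Otimes>\<^sub>M S) \<tau>" by measurable
  then have "(\<lambda>p. snd p n) \<in> borel_measurable (borel \<Otimes>\<^sub>M S)"
    by (simp add: measurable_cong_sets[OF refl sets_eq])
  then show ?case using Suc by (simp add: measurable_apply_polymap)
qed

text \<open>Joint measurability serves twice: its sections at fixed \<open>z\<close> are the escape
  events, and measuring these sections gives a Borel function of \<open>z\<close>.\<close>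

lemma measurable_escapes: "{p. escapes (snd p) (fst p)} \<in> sets (borel \<Otimes>\<^sub>M S)"
proof -
  have "Measurable.pred (borel \<Otimes>\<^sub>M S) (\<lambda>p. escapes (snd p) (fst p))"
    unfolding escapes_def by measurable
  then show ?thesis by (simp add: pred_def space_pair_measure)
qed

lemma sets_escapes: "{\<gamma>. escapes \<gamma> z} \<in> sets S"
  using sets_Pair1[OF measurable_escapes, of z] by (simp add: vimage_def)

lemma T_infty_bounds: "0 \<le> T_infty \<tau> z" "T_infty \<tau> z \<le> 1"
  by (simp_all add: T_infty_eq P.prob_le_1)

lemma measurable_T_infty [measurable]: "T_infty \<tau> \<in> borel_measurable borel"
proof -
  have "(\<lambda>z. emeasure S (Pair z -` {p. escapes (snd p) (fst p)})) \<in> borel_measurable borel"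
    using P.measurable_emeasure_Pair[OF measurable_escapes] .
  then have "(\<lambda>z. enn2real (emeasure S {\<gamma>. escapes \<gamma> z})) \<in> borel_measurable borel"
    by (simp add: vimage_def)
  then show ?thesis by (simp add: T_infty_eq[abs_def] measure_def)
qed

lemma measurable_T_infty_apply:
  "(\<lambda>f. T_infty \<tau> (apply_polymap f z)) \<in> borel_measurable \<tau>"
proof -
  have "(\<lambda>f. apply_polymap f z) \<in> borel_measurable borel" by simp
  then show ?thesis
    using measurable_compose[OF _ measurable_T_infty] by (simp add: measurable_cong_sets[OF sets_eq refl])
qed

lemma integrable_T_infty_apply: "integrable \<tau> (\<lambda>f. T_infty \<tau> (apply_polymap f z))"
  by (rule finite_measure.integrable_const_bound[OF prob_space.finite_measure[OF prob_space_tau], where B = 1]) (simp_all add: T_infty_bounds measurable_T_infty_apply)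

lemma escapes_case_nat: "escapes (case_nat f \<gamma>) z \<longleftrightarrow> escapes \<gamma> (apply_polymap f z)"
  unfolding escapes_def by (subst filterlim_sequentially_Suc[symmetric]) (simp only: random_orbit_case_nat)

text \<open>Prepending an independent first map leaves the product measure unchanged
  (\<open>PiM_iter\<close>). Pulling the escape event back along this operation and integrating over
  sections gives the average over the first map.\<close>

lemma T_infty_invariant: "(\<integral>f. T_infty \<tau> (apply_polymap f z) \<partial>\<tau>) = T_infty \<tau> z"
proof -
  let ?c = "\<lambda>(f, \<gamma>). case_nat f \<gamma> :: nat \<Rightarrow> polymap"
  let ?A = "{\<gamma>. escapes \<gamma> z}"
  have c: "?c \<in> measurable (\<tau> \<Otimes>\<^sub>M S) S" by measurable
  have "emeasure S ?A = emeasure (distr (\<tau> \<Otimes>\<^sub>M S) S ?c) ?A"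
    by (simp only: PiM_iter)
  also have "\<dots> = emeasure (\<tau> \<Otimes>\<^sub>M S) (?c -` ?A \<inter> space (\<tau> \<Otimes>\<^sub>M S))"
    by (rule emeasure_distr[OF c sets_escapes])
  also have "\<dots> = (\<integral>\<^sup>+f. emeasure S (Pair f -` (?c -` ?A \<inter> space (\<tau> \<Otimes>\<^sub>M S))) \<partial>\<tau>)"
    by (intro P.emeasure_pair_measure_alt measurable_sets[OF c sets_escapes])
  also have "\<dots> = (\<integral>\<^sup>+f. ennreal (T_infty \<tau> (apply_polymap f z)) \<partial>\<tau>)"
    by (simp add: space_pair_measure vimage_def escapes_case_nat T_infty_eq P.emeasure_eq_measure)
  also have "\<dots> = ennreal (\<integral>f. T_infty \<tau> (apply_polymap f z) \<partial>\<tau>)"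
    by (rule nn_integral_eq_integral[OF integrable_T_infty_apply]) (simp add: T_infty_bounds)
  finally have "ennreal (T_infty \<tau> z) = ennreal (\<integral>f. T_infty \<tau> (apply_polymap f z) \<partial>\<tau>)"
    by (simp add: T_infty_eq P.emeasure_eq_measure)
  then show ?thesis by (simp add: T_infty_bounds integral_nonneg_AE)
qed

text \<open>One radius serves all maps of the compact support, and beyond it the modulus at least
  doubles at each step. A single visit at any time \<open>n\<close> therefore forces escape.\<close>

lemma escapes_if_near_infty:
  obtains R where "\<And>\<gamma> z n. \<forall>k. \<gamma> k \<in> supp \<tau> \<Longrightarrow> random_orbit \<gamma> n z \<in> near_infty R \<Longrightarrow> escapes \<gamma> z"
proof -
  obtain R where R: "1 \<le> R" "\<And>f w. f \<in> supp \<tau> \<Longrightarrow> R \<le> cmod w \<Longrightarrow>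
      \<exists>u. apply_polymap f (Fin w) = Fin u \<and> 2 * cmod w \<le> cmod u"
    by (rule compact_polymaps_expanding[OF compact_supp]; rule that; blast)
  show thesis
  proof
    fix \<gamma> z n assume \<gamma>: "\<forall>k. \<gamma> k \<in> supp \<tau>" and n: "random_orbit \<gamma> n z \<in> near_infty R"
    have step: "apply_polymap f x \<in> near_infty (2 * r)"
      if f: "f \<in> supp \<tau>" and "R \<le> r" and x: "x \<in> near_infty r" for f x r
    proof (cases x)
      case (Fin w)
      then have "R \<le> cmod w" using that by simp
      then obtain u where "apply_polymap f (Fin w) = Fin u" "2 * cmod w \<le> cmod u"
        using R(2)[OF f] by blast
      then show ?thesis using Fin x by simp
    next
      case Infty
      obtain p where "apply_polymap f = poly_sphere p" by (rule apply_polymap_cases[of f])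
      then show ?thesis using Infty by simp
    qed
    have orbit: "random_orbit \<gamma> (k + n) z \<in> near_infty (2 ^ k * R)" for k
    proof (induction k)
      case (Suc k)
      have "1 * R \<le> 2 ^ k * R" using R(1) by (intro mult_right_mono) simp_all
      then show ?case using step[OF \<gamma>[rule_format] _ Suc, of "k + n"] by (simp add: mult.assoc)
    qed (simp add: n)
    have "eventually (\<lambda>k. random_orbit \<gamma> (k + n) z \<in> near_infty r) sequentially" for r
    proof -
      obtain K where "r < 2 ^ K" using real_arch_pow[of 2 r] by auto
      show ?thesis
        using eventually_ge_at_top[of K]
      proof eventually_elim
        case (elim k)
        have "(2::real) ^ K \<le> 2 ^ k" using elim by (simp add: power_increasing)
        moreover have "(2::real) ^ k * 1 \<le> 2 ^ k * R" using R(1) by (intro mult_left_mono) simp_all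
        ultimately have "r \<le> 2 ^ k * R" using \<open>r < 2 ^ K\<close> by linarith
        then have "near_infty (2 ^ k * R) \<subseteq> near_infty r" by (force simp: near_infty_def)
        then show ?case using orbit by blast
      qed
    qed
    then have "(\<lambda>k. random_orbit \<gamma> (k + n) z) \<longlonglongrightarrow> Infty"
      by (simp add: tendsto_Infty_iff)
    then show "escapes \<gamma> z" unfolding escapes_def by (rule LIMSEQ_offset)
  qed
qed

text \<open>A countable intersection of events of full measure, one for each coordinate.\<close>

lemma AE_supp_sequence: "AE \<gamma> in S. \<forall>n. \<gamma> n \<in> supp \<tau>"
  unfolding AE_all_countable
  by (intro allI AE_PiM_component AE_supp sets_eq prob_space_tau UNIV_I)

lemma T_infty_locally_constant:
  assumes z: "z \<in> Fatou (semigroup_of \<tau>)"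
  obtains r where "0 < r" "\<And>y. y \<in> ball z r \<Longrightarrow> T_infty \<tau> y = T_infty \<tau> z"
proof -
  obtain R where R: "\<And>\<gamma> z n. \<forall>k. \<gamma> k \<in> supp \<tau> \<Longrightarrow> random_orbit \<gamma> n z \<in> near_infty R \<Longrightarrow> escapes \<gamma> z"
    by (rule escapes_if_near_infty; rule that; blast)
  obtain e where e: "0 < e" "ball Infty e \<subseteq> near_infty R"
    using open_contains_ball[of "near_infty R"] open_near_infty near_infty_simps(1) by meson
  obtain U where U: "open U" "z \<in> U" "equicontinuous_on U (semigroup_of \<tau>)"
    using z by (auto simp: Fatou_def)
  have "0 < e / 2" using e by simp
  then obtain d where d: "0 < d" "\<And>g y. g \<in> semigroup_of \<tau> \<Longrightarrow> y \<in> U \<Longrightarrow> dist z y < d \<Longrightarrow>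
      dist (g z) (g y) < e / 2"
    using U(2,3) unfolding equicontinuous_on_def by meson
  obtain r where r: "0 < r" "ball z r \<subseteq> U" using U(1,2) open_contains_ball by meson
  \<comment> \<open>Stated for two arbitrary points with close images, so that it applies both from
    \<open>y\<close> to \<open>z\<close> and back.\<close>
  have transfer: "escapes \<gamma> y"
    if \<gamma>: "\<And>n. \<gamma> n \<in> supp \<tau>" and x: "escapes \<gamma> x"
      and xy: "\<And>g. g \<in> semigroup_of \<tau> \<Longrightarrow> dist (g x) (g y) < e / 2" for \<gamma> x y
  proof -
    have "(\<lambda>n. random_orbit \<gamma> (Suc n) x) \<longlonglongrightarrow> Infty"
      using x unfolding escapes_def by (rule LIMSEQ_Suc)
    then obtain n where "dist (random_orbit \<gamma> (Suc n) x) Infty < e / 2"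
      using \<open>0 < e / 2\<close> by (metis lim_sequentially order_refl)
    moreover have "dist (random_orbit \<gamma> (Suc n) x) (random_orbit \<gamma> (Suc n) y) < e / 2"
      by (intro xy random_orbit_in_semigroup \<gamma>)
    ultimately have "dist Infty (random_orbit \<gamma> (Suc n) y) < e"
      using dist_triangle_half_r by blast
    then have "random_orbit \<gamma> (Suc n) y \<in> near_infty R" using e(2) by (auto simp del: random_orbit.simps)
    then show ?thesis using R \<gamma> by blast
  qed
  show thesis
  proof
    show "0 < min r d" using r d by simp
    fix y assume y: "y \<in> ball z (min r d)"
    then have zy: "dist (g z) (g y) < e / 2" if "g \<in> semigroup_of \<tau>" for g
      using d(2) that r(2) by auto
    then have yz: "dist (g y) (g z) < e / 2" if "g \<in> semigroup_of \<tau>" for g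
      using that by (simp add: dist_commute)
    \<comment> \<open>The two escape events are compared only up to a null set, since the argument
      needs every map of the sequence to lie in the support.\<close>
    have "AE \<gamma> in S. \<gamma> \<in> {\<gamma>. escapes \<gamma> y} \<longleftrightarrow> \<gamma> \<in> {\<gamma>. escapes \<gamma> z}"
      using AE_supp_sequence
    proof eventually_elim
      case (elim \<gamma>)
      then show ?case using transfer[of \<gamma> y z] transfer[of \<gamma> z y] zy yz by auto
    qed
    then show "T_infty \<tau> y = T_infty \<tau> z"
      unfolding T_infty_eq by (rule measure_eq_AE) (rule sets_escapes)+
  qed
qed

end

section \<open>Oscillation\<close>

text \<open>The oscillation of \<open>h\<close> at \<open>x\<close> is the infimum of the
  \<open>c\<close> with this property. Working with such upper bounds avoids nested suprema and
  infima.\<close>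

definition locally_oscillates_le :: "('a::metric_space \<Rightarrow> real) \<Rightarrow> real \<Rightarrow> 'a \<Rightarrow> bool" where
  "locally_oscillates_le h c x \<longleftrightarrow> (\<exists>r>0. \<forall>u\<in>ball x r. \<forall>v\<in>ball x r. \<bar>h u - h v\<bar> \<le> c)"

lemma locally_oscillates_le_mono:
  "locally_oscillates_le h c x \<Longrightarrow> c \<le> c' \<Longrightarrow> locally_oscillates_le h c' x"
  unfolding locally_oscillates_le_def by (meson order_trans)

text \<open>This is upper semicontinuity of the oscillation: points within \<open>r / 2\<close> of
  \<open>x\<close> inherit the bound on balls of radius \<open>r / 2\<close>.\<close>

lemma open_locally_oscillates_le: "open {x. locally_oscillates_le h c x}"
proof (rule openI)
  fix x assume "x \<in> {x. locally_oscillates_le h c x}"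
  then obtain r where r: "0 < r" "\<forall>u\<in>ball x r. \<forall>v\<in>ball x r. \<bar>h u - h v\<bar> \<le> c"
    by (auto simp: locally_oscillates_le_def)
  have "locally_oscillates_le h c y" if y: "y \<in> ball x (r / 2)" for y
  proof -
    have "ball y (r / 2) \<subseteq> ball x r"
    proof
      fix u assume "u \<in> ball y (r / 2)"
      then show "u \<in> ball x r" using y dist_triangle_half_r[of y x r u] by (simp add: dist_commute)
    qed
    then show ?thesis
      unfolding locally_oscillates_le_def using r by (intro exI[of _ "r / 2"]) auto
  qed
  then show "\<exists>e>0. ball x e \<subseteq> {x. locally_oscillates_le h c x}"
    using r(1) by (intro exI[of _ "r / 2"]) auto
qed

lemma continuous_on_if_locally_oscillates_le:
  assumes "\<And>x c. 0 < c \<Longrightarrow> locally_oscillates_le h c x"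
  shows "continuous_on UNIV h"
  unfolding continuous_on_iff
proof (intro ballI allI impI)
  fix x and e :: real assume "0 < e"
  then obtain r where r: "0 < r" "\<forall>u\<in>ball x r. \<forall>v\<in>ball x r. \<bar>h u - h v\<bar> \<le> e / 2"
    using assms[of "e / 2" x] by (auto simp: locally_oscillates_le_def)
  have "dist (h y) (h x) < e" if "dist y x < r" for y
  proof -
    have "y \<in> ball x r" "x \<in> ball x r" using that r(1) by (simp_all add: dist_commute)
    then have "\<bar>h y - h x\<bar> \<le> e / 2" using r(2) by blast
    then show ?thesis using \<open>0 < e\<close> by (simp add: dist_real_def)
  qed
  then show "\<exists>d>0. \<forall>y\<in>UNIV. dist y x < d \<longrightarrow> dist (h y) (h x) < e" using r(1) by blast
qed

text \<open>The contrapositive form of the fact that an upper semicontinuous function attains its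
  supremum on a compact space: finitely many of the open sets cover, and the largest of their bounds
  is still below \<open>s\<close>.\<close>

lemma locally_oscillates_le_compact:
  fixes h :: "'a::metric_space \<Rightarrow> real"
  assumes "compact (UNIV :: 'a set)" and "\<And>x. \<exists>c<s. locally_oscillates_le h c x"
  obtains c where "c < s" "\<And>x. locally_oscillates_le h c x"
proof -
  obtain c where c: "\<And>x. c x < s" "\<And>x. locally_oscillates_le h (c x) x"
    using assms(2) by metis
  obtain X where X: "finite X" "UNIV \<subseteq> (\<Union>a\<in>X. {x. locally_oscillates_le h (c a) x})"
  proof (rule compactE_image[OF assms(1), of UNIV "\<lambda>a. {x. locally_oscillates_le h (c a) x}"])
    show "UNIV \<subseteq> (\<Union>a. {x. locally_oscillates_le h (c a) x})" using c(2) by blast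
  qed (rule open_locally_oscillates_le)
  have ne: "X \<noteq> {}" using X(2) by auto
  show thesis
  proof
    show "Max (c ` X) < s" using X(1) ne c(1) by simp
    fix x
    obtain a where a: "a \<in> X" "locally_oscillates_le h (c a) x" using X(2) by blast
    then show "locally_oscillates_le h (Max (c ` X)) x"
      using X(1) by (intro locally_oscillates_le_mono[OF a(2)]) simp
  qed
qed

section \<open>Maximal oscillation of the escape probability\<close>

context random_polymaps
begin

lemma abs_T_infty_diff_le: "\<bar>T_infty \<tau> u - T_infty \<tau> v\<bar> \<le> 1"
  using T_infty_bounds[of u] T_infty_bounds[of v] by linarith

text \<open>If the oscillation at \<open>z\<close> is the supremum \<open>s\<close>, then it is also \<open>s\<close> at \<open>f z\<close> for every
  \<open>f\<close> in the support: a drop at one \<open>f\<^sub>0 z\<close> would be seen by a neighbourhood of \<open>f\<^sub>0\<close>, which has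
  positive measure, and hence, by invariance of \<open>T_infty\<close>, by the average at \<open>z\<close>. Since only
  \<open>limsup h n \<le> s\<close> is known, dominated convergence is applied to \<open>max s (h n)\<close>.\<close>

lemma maximal_oscillation_invariant:
  assumes upper: "\<And>c x. s < c \<Longrightarrow> locally_oscillates_le (T_infty \<tau>) c x"
    and z: "\<And>c. c < s \<Longrightarrow> \<not> locally_oscillates_le (T_infty \<tau>) c z"
    and f\<^sub>0: "f\<^sub>0 \<in> supp \<tau>" and "c < s"
  shows "\<not> locally_oscillates_le (T_infty \<tau>) c (apply_polymap f\<^sub>0 z)"
proof
  let ?T = "T_infty \<tau>"
  assume "locally_oscillates_le ?T c (apply_polymap f\<^sub>0 z)"
  then obtain r where r: "0 < r"
      "\<And>u v. u \<in> ball (apply_polymap f\<^sub>0 z) r \<Longrightarrow> v \<in> ball (apply_polymap f\<^sub>0 z) r \<Longrightarrow> \<bar>?T u - ?T v\<bar> \<le> c"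
    unfolding locally_oscillates_le_def by blast
  have "isCont (apply_polymap f\<^sub>0) z"
    using continuous_apply_polymap[of UNIV f\<^sub>0] by (simp add: continuous_on_eq_continuous_at)
  moreover have "0 < r / 2" using r(1) by simp
  ultimately obtain d where d: "0 < d"
      "\<And>y. dist y z < d \<Longrightarrow> dist (apply_polymap f\<^sub>0 y) (apply_polymap f\<^sub>0 z) < r / 2"
    unfolding continuous_at_eps_delta by blast
  \<comment> \<open>The radius \<open>r\<close> is split in two: one half for moving the point
    within distance \<open>d\<close> of \<open>z\<close>, the other for replacing
    \<open>f\<^sub>0\<close> by a map in \<open>N\<close>.\<close>
  define N where "N = ball f\<^sub>0 (r / 2)"
  have N: "apply_polymap f y \<in> ball (apply_polymap f\<^sub>0 z) r" if "f \<in> N" "dist y z < d" for f y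
  proof -
    have "dist (apply_polymap f\<^sub>0 y) (apply_polymap f y) < r / 2"
      using dist_apply_polymap_le[of f\<^sub>0 y f] that(1) by (simp add: N_def)
    then show ?thesis
      using dist_triangle_half_r[OF d(2)[OF that(2)]] by simp
  qed
  have N_sets: "N \<in> sets \<tau>" by (simp add: N_def sets_eq)
  have "emeasure \<tau> N > 0" using f\<^sub>0 \<open>0 < r / 2\<close> by (simp add: supp_def N_def)
  then have p: "0 < measure \<tau> N"
    by (simp add: finite_measure.emeasure_eq_measure[OF prob_space.finite_measure[OF prob_space_tau]])
  \<comment> \<open>Since no bound below \<open>s\<close> holds at \<open>z\<close>, there are pairs
    tending to \<open>z\<close> whose values differ by nearly \<open>s\<close>.\<close>
  have "\<exists>u v. dist z u < 1 / Suc n \<and> dist z v < 1 / Suc n \<and> s - 1 / Suc n < \<bar>?T u - ?T v\<bar>" for n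
  proof -
    have "\<not> locally_oscillates_le ?T (s - 1 / Suc n) z" by (intro z) simp
    then show ?thesis
      unfolding locally_oscillates_le_def by (metis mem_ball not_le of_nat_0_less_iff zero_less_Suc zero_less_divide_1_iff)
  qed
  then obtain u v where uv: "\<And>n. dist z (u n) < 1 / Suc n" "\<And>n. dist z (v n) < 1 / Suc n"
      "\<And>n. s - 1 / Suc n < \<bar>?T (u n) - ?T (v n)\<bar>"
    by metis
  define h where "h n f = \<bar>?T (apply_polymap f (u n)) - ?T (apply_polymap f (v n))\<bar>" for n f
  have h_meas: "h n \<in> borel_measurable \<tau>" for n
    unfolding h_def using measurable_T_infty_apply by (intro borel_measurable_abs borel_measurable_diff)
  have h_le: "h n f \<le> 1" "0 \<le> h n f" for n f
    using abs_T_infty_diff_le by (simp_all add: h_def)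
  have small: "eventually (\<lambda>n. 1 / Suc n < e) sequentially" if "0 < e" for e :: real
    using order_tendstoD(2)[OF LIMSEQ_inverse_real_of_nat that] by (simp add: inverse_eq_divide)
  have u_lim: "u \<longlonglongrightarrow> z"
  proof (rule tendstoI)
    fix e :: real assume "0 < e"
    show "eventually (\<lambda>n. dist (u n) z < e) sequentially"
      using small[OF \<open>0 < e\<close>] by eventually_elim (use uv(1) in \<open>metis dist_commute order_less_trans\<close>)
  qed
  have v_lim: "v \<longlonglongrightarrow> z"
  proof (rule tendstoI)
    fix e :: real assume "0 < e"
    show "eventually (\<lambda>n. dist (v n) z < e) sequentially"
      using small[OF \<open>0 < e\<close>] by eventually_elim (use uv(2) in \<open>metis dist_commute order_less_trans\<close>)
  qed
  \<comment> \<open>Both image sequences tend to \<open>apply_polymap f z\<close>, where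
    \<open>upper\<close> bounds the oscillation; the maximum with \<open>s\<close> supplies the
    lower bound.\<close>
  have lim: "(\<lambda>n. max s (h n f)) \<longlonglongrightarrow> s" for f
  proof (rule tendstoI)
    fix e :: real assume "0 < e"
    then have "locally_oscillates_le ?T (s + e / 2) (apply_polymap f z)" by (intro upper) simp
    then obtain r' where r': "0 < r'" "\<And>a b. a \<in> ball (apply_polymap f z) r' \<Longrightarrow>
        b \<in> ball (apply_polymap f z) r' \<Longrightarrow> \<bar>?T a - ?T b\<bar> \<le> s + e / 2"
      unfolding locally_oscillates_le_def by blast
    have "isCont (apply_polymap f) z"
      using continuous_apply_polymap[of UNIV f] by (simp add: continuous_on_eq_continuous_at)
    then have "(\<lambda>n. apply_polymap f (u n)) \<longlonglongrightarrow> apply_polymap f z"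
      "(\<lambda>n. apply_polymap f (v n)) \<longlonglongrightarrow> apply_polymap f z"
      using u_lim v_lim by (simp_all add: isCont_tendsto_compose)
    then have "eventually (\<lambda>n. dist (apply_polymap f (u n)) (apply_polymap f z) < r') sequentially"
      "eventually (\<lambda>n. dist (apply_polymap f (v n)) (apply_polymap f z) < r') sequentially"
      using r'(1) by (simp_all add: tendstoD)
    then show "eventually (\<lambda>n. dist (max s (h n f)) s < e) sequentially"
    proof eventually_elim
      case (elim n)
      then have "h n f \<le> s + e / 2"
        unfolding h_def by (intro r'(2)) (simp_all add: dist_commute)
      then show ?case using \<open>0 < e\<close> by (simp add: dist_real_def)
    qed
  qed
  have bound: "norm (max s (h n f)) \<le> max \<bar>s\<bar> 1" for n f
    using h_le[of n f] by (auto simp: max_def abs_if)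
  have fin: "finite_measure \<tau>" using prob_space_tau by (rule prob_space.finite_measure)
  have g_int: "integrable \<tau> (\<lambda>f. max s (h n f))" for n
    using h_meas bound by (intro finite_measure.integrable_const_bound[OF fin, where B = "max \<bar>s\<bar> 1"]) auto
  have h_int: "integrable \<tau> (h n)" for n
    using h_meas h_le by (intro finite_measure.integrable_const_bound[OF fin, where B = 1]) auto
  have "(\<lambda>n. \<integral>f. max s (h n f) \<partial>\<tau>) \<longlonglongrightarrow> (\<integral>f. s \<partial>\<tau>)"
    using h_meas lim bound finite_measure.integrable_const[OF fin]
    by (intro integral_dominated_convergence[where w = "\<lambda>_. max \<bar>s\<bar> 1"]) auto
  then have int_lim: "(\<lambda>n. \<integral>f. max s (h n f) \<partial>\<tau>) \<longlonglongrightarrow> s"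
    by (simp add: prob_space.prob_space[OF prob_space_tau, simplified])
  have "eventually (\<lambda>n. s - 1 / Suc n \<le> (\<integral>f. max s (h n f) \<partial>\<tau>) - (s - c) * measure \<tau> N) sequentially"
    using small[OF d(1)]
  proof eventually_elim
    case (elim n)
    have "s - 1 / Suc n \<le> \<bar>?T (u n) - ?T (v n)\<bar>" using uv(3)[of n] by simp
    also have "?T (u n) - ?T (v n) = (\<integral>f. ?T (apply_polymap f (u n)) - ?T (apply_polymap f (v n)) \<partial>\<tau>)"
      by (simp add: T_infty_invariant integrable_T_infty_apply)
    also have "\<bar>\<dots>\<bar> \<le> (\<integral>f. h n f \<partial>\<tau>)"
      unfolding h_def by (rule integral_abs_bound)
    also have "\<dots> \<le> (\<integral>f. max s (h n f) - (s - c) * indicator N f \<partial>\<tau>)"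
    proof (rule integral_mono)
      show "integrable \<tau> (\<lambda>f. max s (h n f) - (s - c) * indicator N f)"
        using g_int N_sets fin by (intro Bochner_Integration.integrable_diff integrable_mult_right) (simp_all add: finite_measure.emeasure_finite less_top[symmetric])
      \<comment> \<open>On \<open>N\<close> the left side is at most \<open>c\<close> while the
        maximum is at least \<open>s\<close>, which leaves room to subtract
        \<open>s - c\<close>.\<close>
      show "h n f \<le> max s (h n f) - (s - c) * indicator N f" for f
      proof (cases "f \<in> N")
        case True
        have "dist (u n) z < d" "dist (v n) z < d"
          using uv(1,2)[of n] elim by (simp_all add: dist_commute)
        then have "h n f \<le> c" unfolding h_def by (intro r(2) N True)
        then show ?thesis using True \<open>c < s\<close> by simp
      qed simp
    qed (rule h_int)
    also have "\<dots> = (\<integral>f. max s (h n f) \<partial>\<tau>) - (s - c) * measure \<tau> N"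
      using g_int N_sets fin by (subst Bochner_Integration.integral_diff) (simp_all add: finite_measure.emeasure_finite less_top[symmetric])
    finally show ?case .
  qed
  moreover have "(\<lambda>n. s - 1 / Suc n) \<longlonglongrightarrow> s - 0"
    using LIMSEQ_inverse_real_of_nat by (intro tendsto_intros) (simp add: inverse_eq_divide)
  moreover have "(\<lambda>n. (\<integral>f. max s (h n f) \<partial>\<tau>) - (s - c) * measure \<tau> N) \<longlonglongrightarrow> s - (s - c) * measure \<tau> N"
    by (intro tendsto_intros int_lim)
  \<comment> \<open>In the limit the average falls short of \<open>s\<close> by a fixed positive
    amount.\<close>
  ultimately have "s - 0 \<le> s - (s - c) * measure \<tau> N"
    by (intro tendsto_le[OF sequentially_bot])
  moreover have "0 < (s - c) * measure \<tau> N" using p \<open>c < s\<close> by simp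
  ultimately show False by simp
qed

lemma continuous_T_infty:
  assumes ker: "Julia_ker (semigroup_of \<tau>) = {}"
  shows "continuous_on UNIV (T_infty \<tau>)"
proof -
  let ?T = "T_infty \<tau>"
  \<comment> \<open>The supremum of the oscillation is obtained as the infimum of its uniform
    bounds. The bound \<open>1\<close> belongs to \<open>C\<close> because the values are
    probabilities.\<close>
  define C where "C = {c. 0 \<le> c \<and> (\<forall>x. locally_oscillates_le ?T c x)}"
  define s where "s = Inf C"
  have "locally_oscillates_le ?T 1 x" for x
    using abs_T_infty_diff_le by (auto simp: locally_oscillates_le_def intro!: exI[of _ 1])
  then have "1 \<in> C" unfolding C_def by (intro CollectI conjI allI) simp_all
  then have C: "C \<noteq> {}" "bdd_below C" unfolding C_def by (blast, auto intro: bdd_belowI[of _ 0])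
  have "0 \<le> s" unfolding s_def using C(1) by (intro cInf_greatest) (auto simp: C_def)
  have upper: "locally_oscillates_le ?T c x" if c: "s < c" for c x
  proof -
    obtain c' where "c' \<in> C" "c' < c" using c C by (auto simp: s_def cInf_less_iff)
    then show ?thesis by (auto simp: C_def intro: locally_oscillates_le_mono)
  qed
  have "s = 0"
  proof (rule ccontr)
    assume "s \<noteq> 0"
    then have "0 < s" using \<open>0 \<le> s\<close> by simp
    \<comment> \<open>Together with \<open>upper\<close>, membership in \<open>A\<close> says that
      the oscillation equals \<open>s\<close>.\<close>
    define A where "A = {x. \<forall>c<s. \<not> locally_oscillates_le ?T c x}"
    have "\<exists>z. z \<in> A"
    proof (rule ccontr)
      assume "\<not> (\<exists>z. z \<in> A)"
      then have below: "\<exists>c<s. locally_oscillates_le ?T c x" for x by (auto simp: A_def)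
      obtain c where c: "c < s" "\<And>x. locally_oscillates_le ?T c x"
        by (rule locally_oscillates_le_compact[OF compact_UNIV_rsphere below]; rule that; blast)
      \<comment> \<open>The maximum puts the bound into \<open>C\<close>, whose elements are
        nonnegative; it stays below \<open>s\<close> because \<open>0 < s\<close>.\<close>
      have "locally_oscillates_le ?T (max c 0) x" for x
        by (rule locally_oscillates_le_mono[OF c(2)]) simp
      then have "max c 0 \<in> C" unfolding C_def by (intro CollectI conjI allI) simp_all
      then have "s \<le> max c 0" unfolding s_def using C(2) by (rule cInf_lower)
      then show False using c(1) \<open>0 < s\<close> by simp
    qed
    then obtain z where z: "z \<in> A" by blast
    have step: "apply_polymap f x \<in> A" if "f \<in> supp \<tau>" "x \<in> A" for f x
      unfolding A_def
    proof (intro CollectI allI impI)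
      fix c assume "c < s"
      show "\<not> locally_oscillates_le ?T c (apply_polymap f x)"
        using that(2) by (intro maximal_oscillation_invariant[OF upper _ that(1) \<open>c < s\<close>]) (auto simp: A_def)
    qed
    \<comment> \<open>The point is generalised in the induction because in a composition the outer
      map acts on the image under the inner one.\<close>
    have "g x \<in> A" if "g \<in> semigroup_of \<tau>" "x \<in> A" for g x
      using that unfolding semigroup_of_def
      by (induction arbitrary: x) (auto intro: step)
    moreover have "A \<subseteq> Julia (semigroup_of \<tau>)"
    proof
      fix x assume x: "x \<in> A"
      show "x \<in> Julia (semigroup_of \<tau>)"
      proof (rule ccontr)
        assume "x \<notin> Julia (semigroup_of \<tau>)"
        then have Fatou: "x \<in> Fatou (semigroup_of \<tau>)" by (simp add: Julia_def)
        obtain r where r: "0 < r" "\<And>y. y \<in> ball x r \<Longrightarrow> ?T y = ?T x"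
          by (rule T_infty_locally_constant[OF Fatou]; rule that; blast)
        have "\<bar>?T u - ?T v\<bar> \<le> 0" if "u \<in> ball x r" "v \<in> ball x r" for u v
          unfolding r(2)[OF that(1)] r(2)[OF that(2)] by simp
        \<comment> \<open>Local constancy gives the bound \<open>0\<close>, which is below
          \<open>s\<close> and so excluded on \<open>A\<close>.\<close>
        then have "locally_oscillates_le ?T 0 x"
          unfolding locally_oscillates_le_def using r(1) by blast
        then show False using x \<open>0 < s\<close> by (auto simp: A_def)
      qed
    qed
    ultimately have "z \<in> Julia_ker (semigroup_of \<tau>)"
      using z by (auto simp: Julia_ker_def)
    then show False using ker by simp
  qed
  then show ?thesis using upper by (intro continuous_on_if_locally_oscillates_le) simp
qed

end

theorem theorem3p22:
  fixes \<tau> :: "polymap measure"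
  assumes "\<tau> \<in> M1c"
    and "Julia_ker (semigroup_of \<tau>) = {}"
  shows "range (T_infty \<tau>) \<subseteq> {0..1} \<and> continuous_on UNIV (T_infty \<tau>) \<and>
    M_op \<tau> (T_infty \<tau>) = T_infty \<tau>"
proof -
  interpret random_polymaps \<tau>
    using assms(1) by (intro random_polymaps.intro) (auto simp: M1c_def random_polymaps_axioms_def)
  show ?thesis
    using T_infty_bounds continuous_T_infty[OF assms(2)] T_infty_invariant
    by (auto simp: M_op_def fun_eq_iff)
qed

end
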